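(* Let $G$ be a compact Hausdorff abelian group with Haar probability measure $\mu$ and inner Haar measure $\mu_*$. Let $A$ be any subset of $G$, let $B$ be a $K$-analytic subset of $G$, let $\alpha$ be a real number, and suppose that $0<\mu_*(A+B)\leq\alpha\,\mu_*(A)$. Then for all non-negative integers $m,n$ we have $\mu(mB-nB)\leq\alpha^{m+n}\mu_*(A)$.
   Context: The inner Haar measure of $S\subset G$ is $\mu_*(S)=\sup\{\mu(K):K\subset S,\ K\text{ compact}\}$. A subset $S$ of a topological space $Y$ is a $K_{\sigma\delta}$ set if $S=\bigcap_{i\in\mathbb{N}}\bigcup_{j\in\mathbb{N}}K_{i,j}$ for compact $K_{i,j}\subset Y$. A subset $B$ of a Hausdorff space $X$ is $K$-analytic if there is a $K_{\sigma\delta}$ set $S$ in some Hausdorff space and a continuous map $f:S\to X$ with $B=f(S)$. $mB-nB=\{b_1+\dots+b_m-b_1'-\dots-b_n':b_i,b_j'\in B\}$, with an empty sum equal to $0$. *)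

theory Defs
  imports "HOL-Analysis.Analysis"
begin

definition compact_topological_ab_group :: "'a::{t2_space, ab_group_add} itself \<Rightarrow> bool" where
  "compact_topological_ab_group _ \<longleftrightarrow>
     compact (UNIV :: 'a set) \<and>
     continuous_on UNIV (\<lambda>p::'a \<times> 'a. fst p + snd p) \<and>
     continuous_on UNIV (uminus :: 'a \<Rightarrow> 'a)"

definition haar_prob_measure :: "'a::{topological_space, ab_group_add} measure \<Rightarrow> bool" where
  "haar_prob_measure M \<longleftrightarrow>
     sets M = sets borel \<and> emeasure M (space M) = 1 \<and>
     (\<forall>g. \<forall>S\<in>sets borel. measure M ((\<lambda>x. g + x) ` S) = measure M S) \<and>
     (\<forall>S\<in>sets borel. measure M S = Sup {measure M K | K. compact K \<and> K \<subseteq> S}) \<and>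
     (\<forall>S\<in>sets borel. measure M S = Inf {measure M U | U. open U \<and> S \<subseteq> U})"

definition inner_measure :: "'a::topological_space measure \<Rightarrow> 'a set \<Rightarrow> real" where
  "inner_measure M S = Sup {measure M K | K. compact K \<and> K \<subseteq> S}"

definition K_sigma_delta :: "'b topology \<Rightarrow> 'b set \<Rightarrow> bool" where
  "K_sigma_delta Y S \<longleftrightarrow>
     (\<exists>K :: nat \<Rightarrow> nat \<Rightarrow> 'b set. (\<forall>i j. compactin Y (K i j)) \<and> S = (\<Inter>i. \<Union>j. K i j))"

text \<open>K-analytic subsets, where the witnessing Hausdorff space lives on the type 'b.
  Used as a hypothesis with 'b a free type variable, this quantifies over all Hausdorff spaces.\<close>
definition K_analytic :: "'b itself \<Rightarrow> 'a topology \<Rightarrow> 'a set \<Rightarrow> bool" where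
  "K_analytic _ X B \<longleftrightarrow>
     (\<exists>(Y :: 'b topology) S f. Hausdorff_space Y \<and> K_sigma_delta Y S \<and>
        continuous_map (subtopology Y S) X f \<and> B = f ` S)"

definition sumset :: "'a::plus set \<Rightarrow> 'a set \<Rightarrow> 'a set" where
  "sumset A B = {a + b | a b. a \<in> A \<and> b \<in> B}"

fun iter_sumset :: "nat \<Rightarrow> 'a::monoid_add set \<Rightarrow> 'a set" where
  "iter_sumset 0 B = {0}"
| "iter_sumset (Suc k) B = {x + y | x y. x \<in> B \<and> y \<in> iter_sumset k B}"

definition diff_sumset :: "nat \<Rightarrow> nat \<Rightarrow> 'a::ab_group_add set \<Rightarrow> 'a set" where
  "diff_sumset m n B = {x - y | x y. x \<in> iter_sumset m B \<and> y \<in> iter_sumset n B}"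

end

theory Submission
  imports Defs
begin

text \<open>
  For a compact \<open>C \<subseteq> B\<close> one follows Petridis: if \<open>X \<subseteq> A\<close> nearly minimises
  \<open>\<mu>(X + D) / \<mu>(X)\<close>, where \<open>D\<close> is a small open neighbourhood of \<open>C\<close>, then
  \<open>\<mu>(X + D + Z) \<le> \<beta> \<mu>(X + Z)\<close> for all finite \<open>Z\<close> of bounded size and \<open>\<beta>\<close> slightly larger
  than \<open>\<alpha>\<close>. Since \<open>C\<close> is covered by finitely many small translates, this iterates to
  \<open>\<mu>(X + jC) \<le> \<beta>\<^sup>j \<mu>(X)\<close>, and Ruzsa's triangle inequality
  \<open>\<mu>(X) \<mu>(mC - nC) \<le> \<mu>(X + mC) \<mu>(X + nC)\<close> bounds \<open>\<mu>(mC - nC)\<close>. Choquet's capacitability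
  argument yields compact \<open>C \<subseteq> B\<close> with \<open>\<mu>(mC - nC)\<close> arbitrarily close to the outer measure
  of \<open>mB - nB\<close>, which gives both its measurability and the bound.
\<close>

subsection \<open>Sumsets\<close>

lemma sumset_mono: "A \<subseteq> A' \<Longrightarrow> B \<subseteq> B' \<Longrightarrow> sumset A B \<subseteq> sumset A' B'"
  by (auto simp: sumset_def)

lemma sumset_commute: "sumset A B = sumset B (A :: 'a::ab_semigroup_add set)"
  unfolding sumset_def by (metis add.commute)

lemma sumset_assoc: "sumset (sumset A B) C = sumset A (sumset B (C :: 'a::semigroup_add set))"
  by (auto simp: sumset_def) (metis add.assoc)+

lemma sumset_Un_right: "sumset A (B \<union> C) = sumset A B \<union> sumset A C"
  by (auto simp: sumset_def)

lemma sumset_singleton_right: "sumset A {g} = (+) g ` (A :: 'a::ab_semigroup_add set)"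
  by (auto simp: sumset_def image_iff add.commute)

lemma sumset_0_right: "sumset A {0} = (A :: 'a::monoid_add set)"
  by (auto simp: sumset_def)

lemma finite_sumset: "finite A \<Longrightarrow> finite B \<Longrightarrow> finite (sumset A B)"
  unfolding sumset_def using finite_image_set2[of "\<lambda>a. a \<in> A" "\<lambda>b. b \<in> B"] by simp

lemma iter_sumset_Suc: "iter_sumset (Suc k) B = sumset B (iter_sumset k B)"
  by (simp add: sumset_def)

declare iter_sumset.simps(2) [simp del]

lemma iter_sumset_mono: "B \<subseteq> C \<Longrightarrow> iter_sumset k B \<subseteq> iter_sumset k C"
  by (induction k) (auto simp: iter_sumset_Suc sumset_def)

text \<open>Commutativity regroups the summands; this later separates finite sets from small
  neighbourhoods.\<close>

lemma iter_sumset_sumset: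
  "iter_sumset k (sumset A B) = sumset (iter_sumset k A) (iter_sumset k (B :: 'a::ab_group_add set))"
proof (induction k)
  case 0
  show ?case by (simp add: sumset_0_right)
next
  case (Suc k)
  then show ?case
    by (simp add: iter_sumset_Suc) (metis sumset_assoc sumset_commute)
qed

lemma finite_iter_sumset: "finite B \<Longrightarrow> finite (iter_sumset k B)"
  by (induction k) (auto simp: iter_sumset_Suc finite_sumset)

lemma iter_sumset_ne: "B \<noteq> {} \<Longrightarrow> iter_sumset k B \<noteq> {}"
  by (induction k) (auto simp: iter_sumset_Suc sumset_def)

text \<open>Two indices can be replaced by their maximum, so finitely many summands lie in one
  \<open>R n\<close>. Continuity from below of the capacity rests on this.\<close>

lemma iter_sumset_incseq_UN:
  assumes "incseq R"
  shows "iter_sumset k (\<Union>n. R n) = (\<Union>n. iter_sumset k (R n))"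
proof (induction k)
  case (Suc k)
  have "sumset (\<Union>n. R n) (\<Union>n. iter_sumset k (R n)) \<subseteq> (\<Union>n. sumset (R n) (iter_sumset k (R n)))"
  proof
    fix z assume "z \<in> sumset (\<Union>n. R n) (\<Union>n. iter_sumset k (R n))"
    then obtain i j x y where *: "z = x + y" "x \<in> R i" "y \<in> iter_sumset k (R j)"
      by (auto simp: sumset_def)
    have "x \<in> R (max i j)" "y \<in> iter_sumset k (R (max i j))"
      using * assms iter_sumset_mono[of "R j" "R (max i j)" k]
      by (auto simp: incseq_def) (metis max.cobounded1 subsetD)
    with * show "z \<in> (\<Union>n. sumset (R n) (iter_sumset k (R n)))"
      by (auto simp: sumset_def)
  qed
  then show ?case
    unfolding iter_sumset_Suc Suc.IH by (auto simp: sumset_def)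
qed auto

lemma diff_sumset_eq: "diff_sumset m n B = sumset (iter_sumset m B) (uminus ` iter_sumset n B)"
  unfolding diff_sumset_def sumset_def by (force simp: image_iff)

lemma diff_sumset_mono: "B \<subseteq> C \<Longrightarrow> diff_sumset m n B \<subseteq> diff_sumset m n C"
  unfolding diff_sumset_eq by (intro sumset_mono image_mono iter_sumset_mono)

lemma diff_sumset_sumset:
  "diff_sumset m n (sumset A B) \<subseteq> sumset (diff_sumset m n A) (diff_sumset m n B)"
proof
  fix z assume "z \<in> diff_sumset m n (sumset A B)"
  then obtain a b c d where *: "z = (a + b) - (c + d)" "a \<in> iter_sumset m A" "b \<in> iter_sumset m B"
      "c \<in> iter_sumset n A" "d \<in> iter_sumset n B"
    unfolding diff_sumset_def iter_sumset_sumset by (auto simp: sumset_def)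
  then have "z = (a - c) + (b - d)" by simp
  with * show "z \<in> sumset (diff_sumset m n A) (diff_sumset m n B)"
    unfolding sumset_def diff_sumset_def by blast
qed

lemma diff_sumset_incseq_UN:
  fixes R :: "nat \<Rightarrow> 'a::ab_group_add set"
  assumes "incseq R"
  shows "diff_sumset m n (\<Union>k. R k) = (\<Union>k. diff_sumset m n (R k))"
proof
  show "diff_sumset m n (\<Union>k. R k) \<subseteq> (\<Union>k. diff_sumset m n (R k))"
  proof
    fix z assume "z \<in> diff_sumset m n (\<Union>k. R k)"
    then obtain i j x y where *: "z = x - y" "x \<in> iter_sumset m (R i)" "y \<in> iter_sumset n (R j)"
      by (auto simp: diff_sumset_def iter_sumset_incseq_UN[OF assms])
    have "R i \<subseteq> R (max i j)" "R j \<subseteq> R (max i j)"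
      using assms by (auto simp: incseq_def)
    from iter_sumset_mono[OF this(1), of m] iter_sumset_mono[OF this(2), of n] *
    show "z \<in> (\<Union>k. diff_sumset m n (R k))"
      unfolding diff_sumset_def by blast
  qed
  show "(\<Union>k. diff_sumset m n (R k)) \<subseteq> diff_sumset m n (\<Union>k. R k)"
    by (intro UN_least diff_sumset_mono) auto
qed

subsection \<open>Compact groups with Haar measure\<close>

locale compact_haar_group =
  fixes M :: "'a::{t2_space, ab_group_add} measure"
  assumes compact_group: "compact_topological_ab_group TYPE('a)"
    and haar: "haar_prob_measure M"
begin

lemma sets_M [measurable_cong]: "sets M = sets borel"
  using haar by (simp add: haar_prob_measure_def)

lemma space_M [simp]: "space M = UNIV"
  using sets_eq_imp_space_eq[OF sets_M] by simp

sublocale finite_measure M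
  using haar by (intro finite_measureI) (simp add: haar_prob_measure_def)

lemma measure_UNIV: "measure M UNIV = 1"
  using haar by (simp add: haar_prob_measure_def measure_def)

lemma open_in_M: "open S \<Longrightarrow> S \<in> sets M"
  and compact_in_M: "compact S \<Longrightarrow> S \<in> sets M"
  by (simp_all add: sets_M borel_closed compact_imp_closed)

lemma measure_translate: "S \<in> sets M \<Longrightarrow> measure M ((+) g ` S) = measure M S"
  using haar by (simp add: haar_prob_measure_def sets_M)

lemma outer_regular:
  assumes "S \<in> sets M" "measure M S < r"
  obtains V where "open V" "S \<subseteq> V" "measure M V < r"
proof -
  let ?I = "{measure M U | U. open U \<and> S \<subseteq> U}"
  have "measure M S = Inf ?I"
    using haar assms(1) unfolding haar_prob_measure_def sets_M by blast
  moreover have "?I \<noteq> {}" by (auto intro!: exI[of _ UNIV])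
  ultimately obtain v where "v \<in> ?I" "v < r"
    using cInf_lessD[of ?I r] assms by auto
  then show ?thesis using that by auto
qed

lemma compact_UNIV: "compact (UNIV :: 'a set)"
  and continuous_add: "continuous_on UNIV (\<lambda>p::'a \<times> 'a. fst p + snd p)"
  and continuous_uminus: "continuous_on UNIV (uminus :: 'a \<Rightarrow> 'a)"
  using compact_group by (auto simp: compact_topological_ab_group_def)

lemma continuous_plus: "continuous_on UNIV ((+) (g::'a))"
  using continuous_on_compose2[OF continuous_add, of UNIV "\<lambda>x. (g, x)"]
  by (simp add: continuous_on_Pair)

lemma compact_sumset: "compact A \<Longrightarrow> compact B \<Longrightarrow> compact (sumset A (B::'a set))"
proof -
  assume "compact A" "compact B"
  then have "compact ((\<lambda>p. fst p + snd p) ` (A \<times> B))"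
    by (intro compact_continuous_image compact_Times continuous_on_subset[OF continuous_add]) auto
  also have "(\<lambda>p. fst p + snd p) ` (A \<times> B) = sumset A B"
    by (force simp: sumset_def)
  finally show ?thesis .
qed

lemma compact_uminus: "compact A \<Longrightarrow> compact (uminus ` (A::'a set))"
  by (intro compact_continuous_image continuous_on_subset[OF continuous_uminus]) auto

lemma compact_iter_sumset: "compact B \<Longrightarrow> compact (iter_sumset k (B::'a set))"
  by (induction k) (auto simp: iter_sumset_Suc compact_sumset)

lemma compact_diff_sumset: "compact B \<Longrightarrow> compact (diff_sumset m n (B::'a set))"
  unfolding diff_sumset_eq by (intro compact_sumset compact_uminus compact_iter_sumset)

lemma open_translate:
  assumes "open (U::'a set)" shows "open ((+) g ` U)"
proof -
  have "open ((+) (- g) -` U)"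
    using continuous_plus assms by (simp add: continuous_on_open_vimage)
  also have "(+) (- g) -` U = (+) g ` U"
    by (auto simp: image_iff intro!: bexI[of _ "- g + _"])
  finally show ?thesis .
qed

lemma open_sumset:
  assumes "open (U::'a set)" shows "open (sumset A U)"
proof -
  have "sumset A U = (\<Union>a\<in>A. (+) a ` U)"
    by (auto simp: sumset_def)
  then show ?thesis using open_translate[OF assms] by auto
qed

section \<open>Neighbourhoods of compact sets and of zero\<close>

text \<open>The tube lemma around the slice of \<open>{0}\<close> times \<open>K\<close> in the
  preimage of \<open>V\<close> under addition.\<close>

lemma compact_neighbourhood:
  assumes "compact (K::'a set)" "open V" "K \<subseteq> V"
  obtains U where "open U" "0 \<in> U" "sumset K U \<subseteq> V"
proof -
  have "open ((\<lambda>p::'a \<times> 'a. fst p + snd p) -` V)"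
    using continuous_add assms(2) by (simp add: continuous_on_open_vimage)
  with assms(1) have "\<exists>U. 0 \<in> U \<and> open U \<and> U \<times> K \<subseteq> (\<lambda>p::'a \<times> 'a. fst p + snd p) -` V"
    using assms(3) by (intro Elementary_Topology.tube_lemma) auto
  then obtain U where "0 \<in> U" "open U" "U \<times> K \<subseteq> (\<lambda>p. fst p + snd p) -` V"
    by auto
  then show ?thesis
    by (intro that[of U]) (auto simp: sumset_def add.commute)
qed

lemma zero_neighbourhood_sum:
  assumes "open (V::'a set)" "0 \<in> V"
  obtains U where "open U" "0 \<in> U" "sumset U U \<subseteq> V"
proof -
  have "open ((\<lambda>p::'a \<times> 'a. fst p + snd p) -` V)"
    using continuous_add assms(1) by (simp add: continuous_on_open_vimage)
  then obtain A B where "open A" "open B" "0 \<in> A" "0 \<in> B" "A \<times> B \<subseteq> (\<lambda>p::'a \<times> 'a. fst p + snd p) -` V"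
    using assms(2) unfolding open_prod_def by (force dest!: bspec[of _ _ "(0, 0)"])
  then show ?thesis
    by (intro that[of "A \<inter> B"]) (auto simp: sumset_def)
qed

text \<open>Repeated halving of \<open>V\<close>. One \<open>U\<close> serves all
  \<open>j \<le> k\<close>, so that a single finite cover can later handle every iterated sumset at
  once.\<close>

lemma zero_neighbourhood_iter_sumset:
  assumes "open (V::'a set)" "0 \<in> V"
  obtains U where "open U" "0 \<in> U" "\<And>j. j \<le> k \<Longrightarrow> iter_sumset j U \<subseteq> V"
proof -
  have "\<exists>U. open U \<and> 0 \<in> U \<and> (\<forall>j\<le>k. iter_sumset j U \<subseteq> V)"
    using assms
  proof (induction k arbitrary: V)
    case 0
    then show ?case by auto
  next
    case (Suc k)
    obtain W where W: "open W" "0 \<in> W" "sumset W W \<subseteq> V"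
      using zero_neighbourhood_sum Suc.prems by blast
    obtain U where U: "open U" "0 \<in> U" "\<And>j. j \<le> k \<Longrightarrow> iter_sumset j U \<subseteq> W"
      using Suc.IH[OF W(1,2)] by blast
    have "W \<subseteq> V"
      using W by (force simp: sumset_def)
    moreover have "iter_sumset (Suc k) (U \<inter> W) \<subseteq> V"
      using sumset_mono[of "U \<inter> W" W "iter_sumset k (U \<inter> W)" W] U(3)[of k] W(3)
        iter_sumset_mono[of "U \<inter> W" U k] by (auto simp: iter_sumset_Suc)
    moreover have "iter_sumset j (U \<inter> W) \<subseteq> W" if "j \<le> k" for j
      using U(3)[OF that] iter_sumset_mono[of "U \<inter> W" U j] by auto
    ultimately show ?case
      using U W by (intro exI[of _ "U \<inter> W"]) (auto simp: le_Suc_eq)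
  qed
  then show ?thesis using that by blast
qed

lemma zero_neighbourhood_diff_sumset:
  assumes "open (V::'a set)" "0 \<in> V"
  obtains U where "open U" "0 \<in> U" "diff_sumset m n U \<subseteq> V"
proof -
  obtain W where W: "open W" "0 \<in> W" "sumset W W \<subseteq> V"
    using zero_neighbourhood_sum assms by blast
  have "open (uminus -` W)"
    using W continuous_uminus by (simp add: continuous_on_open_vimage)
  then obtain U where U: "open U" "0 \<in> U" "\<And>j. j \<le> max m n \<Longrightarrow> iter_sumset j U \<subseteq> W \<inter> uminus -` W"
    using zero_neighbourhood_iter_sumset[of "W \<inter> uminus -` W" "max m n"] W by auto
  have "diff_sumset m n U \<subseteq> sumset W W"
    unfolding diff_sumset_eq using U(3)[of m] U(3)[of n] by (intro sumset_mono) auto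
  with U W show ?thesis using that by blast
qed

lemma finite_translates_cover:
  assumes "compact (C::'a set)" "open U" "0 \<in> U"
  obtains Z where "finite Z" "Z \<subseteq> C" "C \<subseteq> sumset Z U"
proof -
  have "C \<subseteq> (\<Union>c\<in>C. (+) c ` U)"
    using assms(3) by force
  with assms(1) open_translate[OF assms(2)] obtain Z where "Z \<subseteq> C" "finite Z" "C \<subseteq> (\<Union>c\<in>Z. (+) c ` U)"
    by (rule compactE_image)
  moreover have "(\<Union>c\<in>Z. (+) c ` U) \<subseteq> sumset Z U"
    by (auto simp: sumset_def)
  ultimately show ?thesis using that[of Z] by simp
qed

end

subsection \<open>The inequalities of Petridis and Ruzsa\<close>

text \<open>Each inserted set gives up what the others already cover. For disjoint pieces the
  measures add up to the measure of the union.\<close>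

lemma finite_disjoint_refinement:
  assumes "finite F" "\<And>g. g \<in> F \<Longrightarrow> S g \<in> sets M"
  obtains E where "disjoint_family_on E F" "\<And>g. g \<in> F \<Longrightarrow> E g \<in> sets M"
    "\<And>g. g \<in> F \<Longrightarrow> E g \<subseteq> S g" "(\<Union>g\<in>F. E g) = (\<Union>g\<in>F. S g)"
proof -
  have "\<exists>E. disjoint_family_on E F \<and> (\<forall>g\<in>F. E g \<in> sets M \<and> E g \<subseteq> S g) \<and>
    (\<Union>g\<in>F. E g) = (\<Union>g\<in>F. S g)"
    using assms
  proof (induction F)
    case (insert g F)
    then obtain E where E: "disjoint_family_on E F" "\<forall>g\<in>F. E g \<in> sets M \<and> E g \<subseteq> S g"
      "(\<Union>g\<in>F. E g) = (\<Union>g\<in>F. S g)"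
      by auto
    define E' where "E' = E(g := S g - (\<Union>h\<in>F. S h))"
    have E'_F: "E' h = E h" if "h \<in> F" for h
      using that insert.hyps by (auto simp: E'_def)
    have "disjoint_family_on E' (insert g F)"
      using E(1) E'_F E(3) insert.hyps
      by (subst disjoint_family_on_insert) (auto simp: disjoint_family_on_def E'_def)
    moreover have "(\<Union>h\<in>F. E' h) = (\<Union>h\<in>F. S h)"
      using E(3) E'_F by simp
    then have "(\<Union>h\<in>insert g F. E' h) = (\<Union>h\<in>insert g F. S h)"
      by (simp add: UN_insert) (simp add: E'_def Un_commute)
    moreover have "E' g \<in> sets M" "E' g \<subseteq> S g"
      using insert.hyps insert.prems by (auto simp: E'_def intro!: sets.Diff sets.finite_UN)
    ultimately show ?case
      using E(2) E'_F by (intro exI[of _ E']) auto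
  qed (auto simp: disjoint_family_on_def)
  then show ?thesis using that by blast
qed

context compact_haar_group
begin

text \<open>Petridis' induction over the elements of \<open>Z\<close>: \<open>K\<close> bounds the
  ratios from below, and \<open>\<eta>\<close> is what \<open>X\<close> may lose against it.
  Compactness of \<open>X\<close> and openness of \<open>D\<close> make the sets measurable.\<close>

lemma petridis_finite:
  fixes K \<eta> :: real
  assumes X: "compact X" and D: "open D"
    and lower: "\<And>W. compact W \<Longrightarrow> W \<subseteq> X \<Longrightarrow> K * measure M W \<le> measure M (sumset W D)"
    and upper: "measure M (sumset X D) \<le> (K + \<eta>) * measure M X"
    and "finite Z"
  shows "measure M (sumset (sumset X D) Z) \<le> K * measure M (sumset X Z) + card Z * \<eta> * measure M X"
  using \<open>finite Z\<close>
proof (induction Z)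
  case empty
  show ?case by (simp add: sumset_def)
next
  case (insert z Z)
  \<comment> \<open>\<open>W\<close> is the part of \<open>X\<close> with \<open>z + W\<close>
    inside \<open>X + Z\<close>. Then \<open>z + W + D\<close> is already in
    \<open>X + D + Z\<close>, while \<open>z + X\<close> enlarges \<open>X + Z\<close> by exactly
    \<open>z + (X - W)\<close>.\<close>
  define W where "W = X \<inter> (+) (- z) ` sumset X Z"
  define P where "P = sumset (sumset X D) Z"
  define Q where "Q = sumset X D"
  have cXZ: "compact (sumset X Z)"
    using X finite_imp_compact[OF insert.hyps(1)] by (rule compact_sumset)
  have "compact ((+) (- z) ` sumset X Z)"
    using cXZ by (intro compact_continuous_image continuous_on_subset[OF continuous_plus]) auto
  then have W: "compact W" "W \<subseteq> X"
    using X unfolding W_def by (auto intro: compact_Int)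
  have openP: "open P"
    unfolding P_def using open_sumset[OF open_sumset[OF D, of X], of Z] by (simp add: sumset_commute)
  have openQ: "open Q" and openWD: "open (sumset W D)"
    unfolding Q_def using D by (auto intro: open_sumset)
  have sets: "P \<in> sets M" "Q \<in> sets M" "sumset W D \<in> sets M" "X \<in> sets M" "W \<in> sets M"
      "sumset X Z \<in> sets M"
    using openP openQ openWD X W cXZ by (auto intro: open_in_M compact_in_M)
  have translate_sets: "(+) z ` S \<in> sets M" if "S \<in> sets M" for S
  proof -
    have "(+) z ` S = (+) (- z) -` S \<inter> space M"
      by (auto simp: image_iff intro!: bexI[of _ "- z + _"])
    moreover have "(+) (- z) \<in> borel_measurable borel"
      using continuous_plus by (rule borel_measurable_continuous_onI)
    ultimately show ?thesis
      using measurable_sets[of "(+) (- z)" M borel S] that by (simp add: sets_M cong: measurable_cong_sets)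
  qed
  have "(+) z ` Q \<subseteq> P \<union> (+) z ` (Q - sumset W D)"
  proof -
    have "(+) z ` sumset W D \<subseteq> P"
    proof
      fix p assume "p \<in> (+) z ` sumset W D"
      then obtain w d where wd: "p = z + (w + d)" "w \<in> W" "d \<in> D"
        by (auto simp: sumset_def)
      then obtain x y where "w = - z + (x + y)" "x \<in> X" "y \<in> Z"
        by (auto simp: W_def sumset_def)
      with wd have "p = (x + d) + y" "x \<in> X" "d \<in> D" "y \<in> Z" by (auto simp: algebra_simps)
      then show "p \<in> P"
        unfolding P_def sumset_def by blast
    qed
    then show ?thesis by auto
  qed
  then have "sumset (sumset X D) (insert z Z) \<subseteq> P \<union> (+) z ` (Q - sumset W D)"
    unfolding insert_is_Un[of z Z] sumset_Un_right sumset_singleton_right P_def Q_def by auto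
  then have "measure M (sumset (sumset X D) (insert z Z)) \<le> measure M (P \<union> (+) z ` (Q - sumset W D))"
    using sets translate_sets by (intro finite_measure_mono) auto
  also have "\<dots> \<le> measure M P + measure M ((+) z ` (Q - sumset W D))"
    using sets translate_sets by (intro measure_Un_le) auto
  also have "measure M ((+) z ` (Q - sumset W D)) = measure M Q - measure M (sumset W D)"
    using sets W sumset_mono[of W X D D] by (simp add: measure_translate Q_def finite_measure_Diff)
  finally have 1: "measure M (sumset (sumset X D) (insert z Z)) \<le>
    measure M P + measure M Q - measure M (sumset W D)" by simp
  have "sumset X (insert z Z) = sumset X Z \<union> (+) z ` X"
    unfolding insert_is_Un[of z Z] sumset_Un_right sumset_singleton_right by auto
  then have "measure M (sumset X (insert z Z)) = measure M (sumset X Z) + measure M ((+) z ` X - sumset X Z)"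
    using sets translate_sets by (simp add: finite_measure_Union')
  also have "(+) z ` X - sumset X Z = (+) z ` (X - W)"
    by (force simp: W_def image_iff)
  also have "measure M \<dots> = measure M X - measure M W"
    using sets W by (simp add: measure_translate finite_measure_Diff)
  finally have "K * measure M (sumset X (insert z Z)) =
    K * measure M (sumset X Z) + K * measure M X - K * measure M W"
    by (simp add: right_diff_distrib distrib_left)
  moreover have "real (card (insert z Z)) * \<eta> * measure M X = card Z * \<eta> * measure M X + \<eta> * measure M X"
    using insert.hyps by (simp add: algebra_simps)
  \<comment> \<open>The growth of \<open>X + D + Z\<close> is at most
    \<open>(K + \<eta>) \<mu>(X) - K \<mu>(W)\<close>, which is \<open>K\<close> times the growth of
    \<open>X + Z\<close> plus one more \<open>\<eta> \<mu>(X)\<close>.\<close>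
  ultimately show ?case
    using 1 lower[OF W] upper insert.IH unfolding P_def Q_def by (simp add: algebra_simps)
qed

text \<open>The infimum of the ratios \<^term>\<open>measure M (sumset X D) / measure M X\<close> over compact
  \<^term>\<open>X \<subseteq> A\<close> need not be attained; a near-minimiser loses a fixed amount for every element
  of \<^term>\<open>Z\<close>, which is harmless once the size of \<^term>\<open>Z\<close> is bounded in advance.\<close>

lemma petridis:
  assumes A: "compact A" "measure M A > 0" and D: "open D"
    and less: "measure M (sumset A D) < \<beta> * measure M A"
  obtains X where "compact X" "X \<subseteq> A" "measure M X > 0"
    "\<And>Z. finite Z \<Longrightarrow> Z \<noteq> {} \<Longrightarrow> card Z \<le> N \<Longrightarrow>
       measure M (sumset (sumset X D) Z) \<le> \<beta> * measure M (sumset X Z)"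
proof -
  let ?r = "\<lambda>X. measure M (sumset X D) / measure M X"
  define R where "R = ?r ` {X. compact X \<and> X \<subseteq> A \<and> measure M X > 0}"
  define K where "K = Inf R"
  \<comment> \<open>Each of up to \<open>N\<close> elements of \<open>Z\<close> may cost
    \<open>\<eta>\<close>; the denominator \<open>N + 1\<close> is positive even for
    \<open>N = 0\<close>.\<close>
  define \<eta> where "\<eta> = (\<beta> - K) / (N + 1)"
  have bdd: "bdd_below R"
    unfolding R_def by (intro bdd_belowI[of _ 0]) auto
  have "?r A \<in> R"
    using A unfolding R_def by blast
  then have "K \<le> ?r A"
    unfolding K_def using bdd by (rule cInf_lower)
  also have "\<dots> < \<beta>"
    using A less by (simp add: field_simps)
  finally have K: "K < \<beta>" .
  then have \<eta>: "\<eta> > 0" by (simp add: \<eta>_def)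
  then have "\<exists>r\<in>R. r < K + \<eta>"
    using cInf_lessD[of R "K + \<eta>"] \<open>?r A \<in> R\<close> unfolding K_def by auto
  then obtain X where X: "compact X" "X \<subseteq> A" "measure M X > 0" "?r X < K + \<eta>"
    unfolding R_def by auto
  have lower: "K * measure M W \<le> measure M (sumset W D)" if "compact W" "W \<subseteq> X" for W
  proof (cases "measure M W > 0")
    case True
    then have "?r W \<in> R"
      using that X unfolding R_def by blast
    then have "K \<le> ?r W"
      unfolding K_def using bdd by (rule cInf_lower)
    with True show ?thesis by (simp add: field_simps)
  next
    case False
    then have "measure M W = 0" using measure_nonneg[of M W] by linarith
    then show ?thesis by simp
  qed
  have upper: "measure M (sumset X D) \<le> (K + \<eta>) * measure M X"
    using X by (simp add: field_simps)
  show ?thesis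
  proof (rule that[OF X(1-3)])
    fix Z :: "'a set" assume Z: "finite Z" "Z \<noteq> {}" "card Z \<le> N"
    then obtain z where "z \<in> Z" by auto
    \<comment> \<open>\<open>X + Z\<close> contains a translate of \<open>X\<close>, so an error
      proportional to \<open>\<mu>(X)\<close> is absorbed by the slack \<open>\<beta> - K\<close> in
      front of \<open>\<mu>(X + Z)\<close>.\<close>
    have "measure M X = measure M ((+) z ` X)"
      using X by (simp add: measure_translate compact_in_M)
    also have "\<dots> \<le> measure M (sumset X Z)"
      using \<open>z \<in> Z\<close> X Z compact_sumset[OF X(1) finite_imp_compact, of Z]
      by (intro finite_measure_mono compact_in_M) (auto simp: sumset_def add.commute)
    finally have XZ: "measure M X \<le> measure M (sumset X Z)" .
    have "card Z * \<eta> \<le> (N + 1) * \<eta>"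
      using Z \<eta> by (intro mult_right_mono) auto
    also have "\<dots> = \<beta> - K" by (simp add: \<eta>_def)
    finally have "card Z * \<eta> * measure M X \<le> (\<beta> - K) * measure M (sumset X Z)"
      using XZ K by (intro mult_mono) auto
    with petridis_finite[OF X(1) D lower upper Z(1)]
    show "measure M (sumset (sumset X D) Z) \<le> \<beta> * measure M (sumset X Z)"
      by (simp add: algebra_simps)
  qed
qed

text \<open>Ruzsa's argument counts the pairs \<open>(p, t)\<close> with \<open>p \<in> X + Y\<close> and \<open>t - p \<in> -(X + Z)\<close>.
  Cutting \<open>X + Y\<close> into small pieces replaces Fubini's theorem, which is not available because
  the Borel sets of a product are in general not generated by Borel rectangles.\<close>

lemma ruzsa_triangle_uminus:
  assumes X: "compact X" and Y: "compact Y" and Z: "compact Z"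
  shows "measure M X * measure M (sumset Y (uminus ` Z)) \<le>
    measure M (sumset X Y) * measure M (uminus ` sumset X Z)"
proof -
  define P where "P = sumset X Y"
  define Q where "Q = uminus ` sumset X Z"
  define T where "T = sumset Y (uminus ` Z)"
  have cpt: "compact P" "compact Q" "compact T"
    unfolding P_def Q_def T_def using assms by (auto intro!: compact_sumset compact_uminus)
  then have sets: "P \<in> sets M" "Q \<in> sets M" "T \<in> sets M"
    by (auto intro: compact_in_M)
  \<comment> \<open>On a piece inside \<open>g + U\<close>, replacing \<open>p\<close> by
    \<open>g\<close> moves \<open>t - p\<close> by an element of \<open>U\<close>; an open
    \<open>V\<close> around \<open>Q\<close> leaves room for this.\<close>
  have bound: "measure M X * measure M T \<le> measure M P * measure M V" if V: "open V" "Q \<subseteq> V" for V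
  proof -
    obtain U where U: "open U" "0 \<in> U" "sumset Q U \<subseteq> V"
      by (rule compact_neighbourhood[OF cpt(2) V])
    obtain F where F: "finite F" "F \<subseteq> P" "P \<subseteq> sumset F U"
      by (rule finite_translates_cover[OF cpt(1) U(1,2)])
    have PU: "P = (\<Union>g\<in>F. P \<inter> (+) g ` U)"
      using F(3) by (fastforce simp: sumset_def)
    have "P \<inter> (+) g ` U \<in> sets M" for g
      using sets U open_translate[of U g] by (auto intro: open_in_M)
    then obtain E where E: "disjoint_family_on E F" "\<And>g. g \<in> F \<Longrightarrow> E g \<in> sets M"
      "\<And>g. g \<in> F \<Longrightarrow> E g \<subseteq> P \<inter> (+) g ` U" "(\<Union>g\<in>F. E g) = P"
      using finite_disjoint_refinement[OF F(1), of "\<lambda>g. P \<inter> (+) g ` U" M] PU by metis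
    have gV: "(+) g ` V \<in> sets M" for g
      using V open_translate by (auto intro: open_in_M)
    \<comment> \<open>For \<open>t = y - z\<close> the whole translate \<open>y + X\<close> lies in
      \<open>P\<close>, and \<open>t - p\<close> is in \<open>Q\<close> for each of its points
      \<open>p\<close>. The pieces meeting it have total measure at least \<open>\<mu>(X)\<close>,
      and their indices satisfy \<open>t \<in> g + V\<close>.\<close>
    have pointwise: "measure M X * indicator T t \<le> (\<Sum>g\<in>F. measure M (E g) * indicator ((+) g ` V) t)" for t
    proof (cases "t \<in> T")
      case True
      then obtain y z where t: "t = y - z" "y \<in> Y" "z \<in> Z"
        by (auto simp: T_def sumset_def)
      define F' where "F' = {g \<in> F. t \<in> (+) g ` V}"
      have "(+) y ` X \<subseteq> (\<Union>g\<in>F'. E g)"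
      proof
        fix p assume "p \<in> (+) y ` X"
        then obtain x where x: "p = y + x" "x \<in> X" by auto
        then have "p \<in> P"
          unfolding P_def sumset_def using t by (auto simp: add.commute)
        then obtain g where g: "g \<in> F" "p \<in> E g" using E(4) by auto
        then obtain u where u: "u \<in> U" "p = g + u" using E(3) by blast
        have "- (x + z) \<in> Q"
          unfolding Q_def sumset_def using x t by blast
        then have "- (x + z) + u \<in> V"
          using u U(3) by (auto simp: sumset_def)
        moreover have "t = g + (- (x + z) + u)"
          using t(1) x(1) u(2) by (simp add: algebra_simps)
        ultimately have "g \<in> F'" using g unfolding F'_def by blast
        with g show "p \<in> (\<Union>g\<in>F'. E g)" by auto
      qed
      then have "measure M ((+) y ` X) \<le> measure M (\<Union>g\<in>F'. E g)"
        using F(1) E(2) by (intro finite_measure_mono sets.finite_UN) (auto simp: F'_def)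
      also have "\<dots> \<le> (\<Sum>g\<in>F'. measure M (E g))"
        using F(1) E(2) by (intro measure_UNION_le) (auto simp: F'_def)
      also have "\<dots> = (\<Sum>g\<in>F. measure M (E g) * indicator ((+) g ` V) t)"
        unfolding F'_def using F(1) by (intro sum.mono_neutral_cong_left) (auto simp: indicator_def)
      finally show ?thesis
        using True X by (simp add: measure_translate compact_in_M)
    qed (auto intro!: sum_nonneg)
    have "measure M X * measure M T = (\<integral>t. measure M X * indicator T t \<partial>M)"
      using sets by simp
    also have "\<dots> \<le> (\<integral>t. (\<Sum>g\<in>F. measure M (E g) * indicator ((+) g ` V) t) \<partial>M)"
      using sets gV pointwise
      by (intro integral_mono Bochner_Integration.integrable_sum integrable_mult_right)
         (auto simp: less_top[symmetric])
    also have "\<dots> = (\<Sum>g\<in>F. measure M (E g) * measure M ((+) g ` V))"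
      using gV by (subst Bochner_Integration.integral_sum) (auto simp: less_top[symmetric])
    also have "\<dots> = (\<Sum>g\<in>F. measure M (E g)) * measure M V"
      using V by (simp add: measure_translate open_in_M sum_distrib_right)
    also have "(\<Sum>g\<in>F. measure M (E g)) = measure M P"
      using E F(1) finite_measure_finite_Union[of F E] by (simp add: image_subset_iff)
    finally show ?thesis .
  qed
  \<comment> \<open>Outer regularity lets \<open>V\<close> shrink to \<open>Q\<close>; if
    \<open>P\<close> is null, \<open>V = UNIV\<close> already suffices.\<close>
  have "measure M X * measure M T \<le> measure M P * measure M Q"
  proof (rule ccontr)
    assume neg: "\<not> ?thesis"
    show False
    proof (cases "measure M P > 0")
      case True
      then have "measure M Q < measure M X * measure M T / measure M P"
        using neg by (simp add: field_simps)
      then obtain V where "open V" "Q \<subseteq> V" "measure M V < measure M X * measure M T / measure M P"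
        using outer_regular[OF sets(2)] by metis
      then show False
        using bound[of V] True by (simp add: field_simps)
    next
      case False
      then have "measure M P = 0" using measure_nonneg[of M P] by linarith
      then show False using bound[of UNIV] neg by simp
    qed
  qed
  then show ?thesis by (simp add: P_def Q_def T_def)
qed

text \<open>Inversion invariance falls out of \<open>ruzsa_triangle_uminus\<close>: for
  \<open>Y = UNIV\<close> and \<open>Z = {0}\<close> it reads
  \<open>\<mu>(S) \<le> \<mu>(-S)\<close>, and the same holds for \<open>-S\<close>.\<close>

lemma measure_uminus_compact:
  assumes "compact Q" shows "measure M (uminus ` Q) = measure M Q"
proof -
  have le: "measure M S \<le> measure M (uminus ` S)" if S: "compact S" for S
  proof (cases "S = {}")
    case False
    then obtain s where "s \<in> S" by auto
    have "x \<in> sumset S UNIV" for x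
      unfolding sumset_def mem_Collect_eq using \<open>s \<in> S\<close> by (intro exI[of _ s] exI[of _ "x - s"]) simp
    then have "sumset S UNIV = UNIV" by auto
    then show ?thesis
      using ruzsa_triangle_uminus[OF S compact_UNIV, of "{0}"] by (simp add: sumset_0_right measure_UNIV)
  qed simp
  from le[OF assms] le[OF compact_uminus[OF assms]] show ?thesis
    by (simp add: image_image)
qed

lemma ruzsa_triangle:
  assumes "compact X" "compact Y" "compact Z"
  shows "measure M X * measure M (sumset Y (uminus ` Z)) \<le> measure M (sumset X Y) * measure M (sumset X Z)"
  using ruzsa_triangle_uminus[OF assms] measure_uminus_compact[OF compact_sumset] assms by simp

section \<open>Pluennecke's inequality for compact sets\<close>

text \<open>The strict hypothesis leaves room to thicken \<open>C\<close> to an open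
  \<open>D\<close> with the same inequality, to which \<open>petridis\<close> applies; a finite
  \<open>Z\<close> then stands in for \<open>C\<close>.\<close>

lemma plunnecke_compact_less:
  assumes A: "compact A" "measure M A > 0" and C: "compact C" "C \<noteq> {}"
    and less: "measure M (sumset A C) < \<beta> * measure M A"
  shows "measure M (diff_sumset m n C) \<le> \<beta> ^ (m + n) * measure M A"
proof -
  have "0 \<le> \<beta> * measure M A"
    using less measure_nonneg[of M "sumset A C"] by linarith
  then have \<beta>: "\<beta> \<ge> 0"
    using A by (simp add: zero_le_mult_iff)
  have cAC: "compact (sumset A C)"
    using A C by (intro compact_sumset)
  obtain V where V: "open V" "sumset A C \<subseteq> V" "measure M V < \<beta> * measure M A"
    by (rule outer_regular[OF compact_in_M[OF cAC] less])
  obtain U where U: "open U" "0 \<in> U" "sumset (sumset A C) U \<subseteq> V"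
    by (rule compact_neighbourhood[OF cAC V(1,2)])
  define D where "D = sumset C U"
  have D: "open D" "C \<subseteq> D"
    using U open_sumset[of U C] by (auto simp: D_def sumset_def) force
  have "measure M (sumset A D) \<le> measure M V"
    using U V by (intro finite_measure_mono open_in_M) (auto simp: D_def sumset_assoc)
  with V have AD: "measure M (sumset A D) < \<beta> * measure M A" by simp
  \<comment> \<open>The errors of \<open>j\<close> approximations by \<open>Z\<close>, added up,
    must still fit into the single \<open>U\<close> in \<open>D = C + U\<close>.\<close>
  obtain U' where U': "open U'" "0 \<in> U'" "\<And>j. j \<le> max m n \<Longrightarrow> iter_sumset j U' \<subseteq> U"
    using zero_neighbourhood_iter_sumset[OF U(1,2), of "max m n"] by metis
  obtain Z where Z: "finite Z" "Z \<subseteq> C" "C \<subseteq> sumset Z U'"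
    by (rule finite_translates_cover[OF C(1) U'(1,2)])
  have "Z \<noteq> {}" using Z C by (auto simp: sumset_def)
  \<comment> \<open>\<open>Z\<close> is found without reference to \<open>X\<close>, so this bound
    on its iterated sumsets is available before \<open>X\<close> is chosen.\<close>
  define N where "N = (\<Sum>j\<le>max m n. card (iter_sumset j Z))"
  obtain X where X: "compact X" "X \<subseteq> A" "measure M X > 0"
    and XD: "\<And>Z. finite Z \<Longrightarrow> Z \<noteq> {} \<Longrightarrow> card Z \<le> N \<Longrightarrow>
       measure M (sumset (sumset X D) Z) \<le> \<beta> * measure M (sumset X Z)"
    using petridis[OF A D(1) AD, of N] by blast
  have step: "measure M (sumset (sumset X D) (iter_sumset j Z)) \<le> \<beta> * measure M (sumset X (iter_sumset j Z))"
    if "j \<le> max m n" for j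
  proof (rule XD)
    show "card (iter_sumset j Z) \<le> N"
      unfolding N_def using that by (intro member_le_sum) auto
  qed (use Z \<open>Z \<noteq> {}\<close> in \<open>auto intro: finite_iter_sumset simp: iter_sumset_ne\<close>)
  have XDZ_sets: "sumset (sumset X D) S \<in> sets M" for S
    using open_sumset[OF open_sumset[OF D(1), of X], of S] by (simp add: sumset_commute open_in_M)
  have XZ: "measure M (sumset X (iter_sumset j Z)) \<le> \<beta> ^ j * measure M X" if "j \<le> max m n" for j
    using that
  proof (induction j)
    case 0
    show ?case by (simp add: sumset_0_right)
  next
    case (Suc j)
    have "sumset X (iter_sumset (Suc j) Z) \<subseteq> sumset (sumset X D) (iter_sumset j Z)"
      unfolding iter_sumset_Suc sumset_assoc using Z D by (intro sumset_mono) auto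
    then have "measure M (sumset X (iter_sumset (Suc j) Z)) \<le> measure M (sumset (sumset X D) (iter_sumset j Z))"
      using XDZ_sets by (intro finite_measure_mono)
    also have "\<dots> \<le> \<beta> * measure M (sumset X (iter_sumset j Z))"
      using Suc by (intro step) simp
    also have "\<dots> \<le> \<beta> * (\<beta> ^ j * measure M X)"
      using Suc \<beta> by (intro mult_left_mono) auto
    finally show ?case by (simp add: mult.assoc)
  qed
  \<comment> \<open>One summand absorbs the neighbourhood: for \<open>j = i + 1\<close>,
    \<open>jC\<close> lies in \<open>C + iZ + U = D + iZ\<close>, so the exponent stays exactly
    \<open>j\<close>.\<close>
  have XC: "measure M (sumset X (iter_sumset j C)) \<le> \<beta> ^ j * measure M X" if j: "j \<le> max m n" for j
  proof (cases j)
    case 0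
    then show ?thesis by (simp add: sumset_0_right)
  next
    case (Suc i)
    have "iter_sumset j C \<subseteq> iter_sumset j (sumset Z U')"
      using Z by (intro iter_sumset_mono)
    also have "\<dots> = sumset (sumset Z (iter_sumset i Z)) (iter_sumset j U')"
      by (simp add: iter_sumset_sumset) (simp add: Suc iter_sumset_Suc)
    also have "\<dots> \<subseteq> sumset (sumset C (iter_sumset i Z)) U"
      using Z U'(3)[OF j] by (intro sumset_mono) auto
    also have "\<dots> = sumset D (iter_sumset i Z)"
      unfolding D_def by (metis sumset_assoc sumset_commute)
    finally have "sumset X (iter_sumset j C) \<subseteq> sumset (sumset X D) (iter_sumset i Z)"
      unfolding sumset_assoc by (intro sumset_mono) auto
    then have "measure M (sumset X (iter_sumset j C)) \<le> measure M (sumset (sumset X D) (iter_sumset i Z))"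
      using XDZ_sets by (intro finite_measure_mono)
    also have "\<dots> \<le> \<beta> * measure M (sumset X (iter_sumset i Z))"
      using j Suc by (intro step) simp
    also have "\<dots> \<le> \<beta> * (\<beta> ^ i * measure M X)"
      using j Suc \<beta> by (intro mult_left_mono XZ) auto
    finally show ?thesis by (simp add: Suc mult.assoc)
  qed
  \<comment> \<open>With \<open>X\<close> as the pivot of Ruzsa's inequality, one factor
    \<open>\<mu>(X)\<close> cancels and the other is at most \<open>\<mu>(A)\<close>.\<close>
  have "measure M X * measure M (diff_sumset m n C) \<le>
      measure M (sumset X (iter_sumset m C)) * measure M (sumset X (iter_sumset n C))"
    unfolding diff_sumset_eq using X C by (intro ruzsa_triangle compact_iter_sumset) auto
  also have "\<dots> \<le> (\<beta> ^ m * measure M X) * (\<beta> ^ n * measure M X)"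
    using \<beta> by (intro mult_mono XC) auto
  also have "\<dots> = measure M X * (\<beta> ^ (m + n) * measure M X)"
    by (simp add: power_add)
  finally have "measure M (diff_sumset m n C) \<le> \<beta> ^ (m + n) * measure M X"
    using X by simp
  also have "\<dots> \<le> \<beta> ^ (m + n) * measure M A"
    using \<beta> X A by (intro mult_left_mono finite_measure_mono compact_in_M) auto
  finally show ?thesis .
qed

end

subsection \<open>K-analytic sets\<close>

text \<open>Otherwise the sets \<open>P k - W\<close> are nonempty, closed and nested inside the
  compact \<open>P 0\<close>, so they share a point, which is in every \<open>P k\<close> but not in
  \<open>W\<close>.\<close>

lemma compactin_decseq_subset_openin:
  assumes Y: "Hausdorff_space Y" and P: "\<And>k. compactin Y (P k)" "decseq P"
    and W: "openin Y W" "(\<Inter>k. P k) \<subseteq> W"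
  obtains k :: nat where "P k \<subseteq> W"
proof -
  have "\<exists>k. P k - W = {}"
  proof (rule ccontr)
    assume ne: "\<nexists>k. P k - W = {}"
    have closed: "closedin Y (P k)" for k
      using Y P by (intro compactin_imp_closedin)
    have "(\<Inter>k. P k - W) \<noteq> {}"
    proof (rule compact_space_imp_nest)
      show "compact_space (subtopology Y (P 0))"
        using P by (simp add: compactin_subspace)
      show "closedin (subtopology Y (P 0)) (P k - W)" for k
        using closed W decseqD[OF P(2), of 0 k]
        by (simp add: closedin_closed_subtopology closedin_diff) blast
      show "decseq (\<lambda>k. P k - W)"
        using P(2) by (auto simp: decseq_def)
    qed (use ne in auto)
    with W(2) show False by auto
  qed
  then show ?thesis using that by blast
qed

context compact_haar_group
begin

text \<open>Choquet's capacitability argument, applied to the set function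
  \<open>R \<mapsto> outer_measure_of M (diff_sumset m n (f ` R))\<close> on subsets of the \<open>K\<^sub>\<sigma>\<^sub>\<delta>\<close> set.\<close>

lemma K_analytic_capacitable:
  assumes B: "K_analytic TYPE('b) euclidean B"
    and r: "ennreal r < outer_measure_of M (diff_sumset m n B)"
  obtains C where "compact C" "C \<subseteq> B" "r \<le> measure M (diff_sumset m n C)"
proof -
  obtain Y :: "'b topology" and S f where Y: "Hausdorff_space Y" and S: "K_sigma_delta Y S"
    and f: "continuous_map (subtopology Y S) euclidean f" and Bf: "B = f ` S"
    using B unfolding K_analytic_def by blast
  obtain K :: "nat \<Rightarrow> nat \<Rightarrow> 'b set" where K: "\<And>i j. compactin Y (K i j)" and SK: "S = (\<Inter>i. \<Union>j. K i j)"
    using S unfolding K_sigma_delta_def by blast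
  define \<Phi> where "\<Phi> R = outer_measure_of M (diff_sumset m n (f ` R))" for R
  have \<Phi>_incseq: "(SUP k. \<Phi> (R k)) = \<Phi> (\<Union>k. R k)" if "incseq R" for R
  proof -
    have inc: "incseq (\<lambda>k. f ` R k)"
      using that by (auto simp: incseq_def)
    then have "incseq (\<lambda>k. diff_sumset m n (f ` R k))"
      unfolding incseq_def using diff_sumset_mono by blast
    then show ?thesis
      unfolding \<Phi>_def image_UN diff_sumset_incseq_UN[OF inc] by (intro SUP_outer_measure_of_incseq) auto
  qed
  \<comment> \<open>Finite unions make each layer increasing in \<open>j\<close>, as continuity of
    \<open>\<Phi>\<close> from below requires.\<close>
  define L where "L i j = (\<Union>l\<le>j. K i l)" for i j
  have L: "compactin Y (L i j)" for i j
    unfolding L_def using K by (intro compactin_Union) auto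
  then have L_closed: "closedin Y (L i j)" for i j
    using Y by (intro compactin_imp_closedin)
  \<comment> \<open>\<open>R\<close> is cut down layer by layer, each time to its part in one
    compact \<open>L k j\<close>, while \<open>\<Phi>\<close> stays above \<open>r\<close>.\<close>
  have "\<exists>R. \<forall>k. (R k \<subseteq> S \<and> ennreal r < \<Phi> (R k)) \<and> (\<exists>j. R (Suc k) = R k \<inter> L k j)"
  proof (rule dependent_nat_choice)
    show "\<exists>R. R \<subseteq> S \<and> ennreal r < \<Phi> R"
      using r by (auto simp: \<Phi>_def Bf)
  next
    fix R k assume R: "R \<subseteq> S \<and> ennreal r < \<Phi> R"
    have "incseq (\<lambda>j. R \<inter> L k j)"
      by (force simp: incseq_def L_def)
    moreover have "(\<Union>j. R \<inter> L k j) = R"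
      using R unfolding SK L_def by blast
    ultimately have "(SUP j. \<Phi> (R \<inter> L k j)) = \<Phi> R"
      using \<Phi>_incseq[of "\<lambda>j. R \<inter> L k j"] by simp
    with R obtain j where "ennreal r < \<Phi> (R \<inter> L k j)"
      by (metis less_SUP_iff)
    with R show "\<exists>R'. (R' \<subseteq> S \<and> ennreal r < \<Phi> R') \<and> (\<exists>j. R' = R \<inter> L k j)"
      by blast
  qed
  then obtain R where R: "\<And>k. R k \<subseteq> S" "\<And>k. ennreal r < \<Phi> (R k)"
    and RL: "\<And>k. \<exists>j. R (Suc k) = R k \<inter> L k j"
    by blast
  from RL obtain J where J: "\<And>k. R (Suc k) = R k \<inter> L k (J k)"
    by metis
  \<comment> \<open>\<open>R k\<close> need not be compact, so it is enclosed: \<open>P k\<close> is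
    compact and contains \<open>R (Suc k)\<close>. The intersection \<open>N\<close> of all
    \<open>P k\<close> lies in a member of every layer, hence in \<open>S\<close>.\<close>
  define P where "P k = (\<Inter>i\<le>k. L i (J i))" for k
  have P_compact: "compactin Y (P k)" for k
    unfolding P_def using L L_closed by (intro closed_compactin_Inter[of Y "L 0 (J 0)"]) auto
  have P_dec: "decseq P"
    by (force simp: decseq_def P_def)
  have R_dec: "decseq R"
    using J by (intro decseq_SucI) auto
  have RP: "R (Suc k) \<subseteq> P k" for k
    using J decseqD[OF R_dec, of "Suc _" "Suc k"] unfolding P_def by fastforce
  define N where "N = (\<Inter>k. P k)"
  have NS: "N \<subseteq> S"
    unfolding N_def P_def SK L_def by blast
  have "compactin Y N"
    unfolding N_def using P_compact Y by (intro closed_compactin_Inter[of Y "P 0"] compactin_imp_closedin) auto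
  then have "compactin (subtopology Y S) N"
    using NS by (simp add: compactin_subtopology)
  then have C: "compact (f ` N)"
    using image_compactin[OF _ f] by (simp flip: compactin_euclidean_iff)
  \<comment> \<open>If \<open>N\<close> fell short, an open \<open>V\<close> of measure below
    \<open>r\<close> would already contain the difference sumset of \<open>f\<close> on some
    \<open>R (Suc k)\<close>.\<close>
  have "r \<le> measure M (diff_sumset m n (f ` N))"
  proof (rule ccontr)
    assume "\<not> ?thesis"
    then have less: "measure M (diff_sumset m n (f ` N)) < r" by simp
    have cpt: "compact (diff_sumset m n (f ` N))"
      using C by (rule compact_diff_sumset)
    obtain V where V: "open V" "diff_sumset m n (f ` N) \<subseteq> V" "measure M V < r"
      by (rule outer_regular[OF compact_in_M[OF cpt] less])
    obtain U where U: "open U" "0 \<in> U" "sumset (diff_sumset m n (f ` N)) U \<subseteq> V"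
      by (rule compact_neighbourhood[OF cpt V(1,2)])
    obtain U' where U': "open U'" "0 \<in> U'" "diff_sumset m n U' \<subseteq> U"
      by (rule zero_neighbourhood_diff_sumset[OF U(1,2)])
    define O' where "O' = sumset (f ` N) U'"
    have O': "open O'" "f ` N \<subseteq> O'"
      using U' open_sumset[of U' "f ` N"] by (force simp: O'_def sumset_def)+
    \<comment> \<open>Continuity of \<open>f\<close> is given on \<open>S\<close>, whereas
      \<open>P k\<close> may leave \<open>S\<close>. So \<open>W\<close> is taken open in
      \<open>Y\<close> to catch some \<open>P k\<close>, and \<open>R (Suc k) \<subseteq> S\<close>
      leads back to the preimage of \<open>O'\<close>.\<close>
    have "openin (subtopology Y S) {x \<in> topspace (subtopology Y S). f x \<in> O'}"
      using f O' by (intro openin_continuous_map_preimage) auto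
    then obtain W where W: "openin Y W" "{x \<in> topspace (subtopology Y S). f x \<in> O'} = W \<inter> S"
      unfolding openin_subtopology by blast
    have top: "topspace (subtopology Y S) = S"
      using K compactin_subset_topspace unfolding SK by fastforce
    have "N \<subseteq> W"
      using W(2) O'(2) NS unfolding top by blast
    then obtain k where "P k \<subseteq> W"
      using compactin_decseq_subset_openin[OF Y P_compact P_dec W(1)] unfolding N_def by blast
    then have "f ` R (Suc k) \<subseteq> O'"
      using RP[of k] R(1)[of "Suc k"] W(2) unfolding top by blast
    then have "diff_sumset m n (f ` R (Suc k)) \<subseteq> diff_sumset m n O'"
      by (rule diff_sumset_mono)
    also have "\<dots> \<subseteq> sumset (diff_sumset m n (f ` N)) (diff_sumset m n U')"
      unfolding O'_def by (rule diff_sumset_sumset)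
    also have "\<dots> \<subseteq> V"
      using U(3) U'(3) sumset_mono by blast
    finally have "\<Phi> (R (Suc k)) \<le> outer_measure_of M V"
      unfolding \<Phi>_def by (rule outer_measure_of_mono)
    also have "\<dots> = ennreal (measure M V)"
      using V by (simp add: open_in_M emeasure_eq_measure)
    also have "\<dots> \<le> ennreal r"
      using V by (intro ennreal_leI) simp
    finally show False
      using R(2)[of "Suc k"] by simp
  qed
  with C NS that show ?thesis
    unfolding Bf by blast
qed

section \<open>Inner measure and the passage to general summands\<close>

lemma measure_le_inner_measure:
  assumes "compact K" "K \<subseteq> S" shows "measure M K \<le> inner_measure M S"
  unfolding inner_measure_def
proof (rule cSup_upper)
  show "bdd_above {measure M K |K. compact K \<and> K \<subseteq> S}"
    using bounded_measure by (auto intro!: bdd_aboveI)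
qed (use assms in blast)

lemma less_inner_measureE:
  assumes "r < inner_measure M S"
  obtains K where "compact K" "K \<subseteq> S" "r < measure M K"
proof -
  have "{measure M K |K. compact K \<and> K \<subseteq> S} \<noteq> {}"
    by (auto intro!: exI[of _ "{}"])
  then show ?thesis
    using less_cSupD[of "{measure M K |K. compact K \<and> K \<subseteq> S}" r] assms that
    unfolding inner_measure_def by blast
qed

text \<open>\<open>A\<close> is approximated from inside by a compact \<open>A'\<close>. As the
  inner measure need not be attained, some \<open>\<beta> > \<alpha>\<close> pays for the loss and
  is then sent to \<open>\<alpha>\<close>.\<close>

lemma plunnecke_compact_summand:
  assumes pos: "0 < inner_measure M (sumset A B)"
    and le: "inner_measure M (sumset A B) \<le> \<alpha> * inner_measure M A"
    and C: "compact C" "C \<noteq> {}" "C \<subseteq> B"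
  shows "measure M (diff_sumset m n C) \<le> \<alpha> ^ (m + n) * inner_measure M A"
proof -
  have A_nonneg: "0 \<le> inner_measure M A"
    using measure_le_inner_measure[of "{}" A] by simp
  have "0 < \<alpha> * inner_measure M A"
    using pos le by simp
  with A_nonneg have A_pos: "0 < inner_measure M A" and \<alpha>: "0 < \<alpha>"
    by (auto simp: zero_less_mult_iff)
  have less: "measure M (diff_sumset m n C) \<le> \<beta> ^ (m + n) * inner_measure M A" if \<beta>: "\<alpha> < \<beta>" for \<beta>
  proof -
    \<comment> \<open>This threshold yields
      \<open>\<alpha> * inner_measure M A < \<beta> * measure M A'\<close>; being positive, it also
      forces \<open>A'\<close> to have positive measure.\<close>
    have "\<alpha> * inner_measure M A / \<beta> < inner_measure M A"
      using \<alpha> \<beta> A_pos by (simp add: field_simps)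
    then obtain A' where A': "compact A'" "A' \<subseteq> A" "\<alpha> * inner_measure M A / \<beta> < measure M A'"
      by (rule less_inner_measureE)
    have "0 < \<alpha> * inner_measure M A / \<beta>"
      using \<alpha> \<beta> A_pos by simp
    then have A'_pos: "0 < measure M A'"
      using A' by linarith
    have "measure M (sumset A' C) \<le> inner_measure M (sumset A B)"
      using A' C by (intro measure_le_inner_measure compact_sumset sumset_mono)
    also have "\<dots> < \<beta> * measure M A'"
      using le A'(3) \<alpha> \<beta> by (simp add: field_simps)
    finally have "measure M (diff_sumset m n C) \<le> \<beta> ^ (m + n) * measure M A'"
      using A' A'_pos C by (intro plunnecke_compact_less)
    also have "\<dots> \<le> \<beta> ^ (m + n) * inner_measure M A"
      using A' \<alpha> \<beta> by (intro mult_left_mono measure_le_inner_measure) auto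
    finally show ?thesis .
  qed
  have "((\<lambda>\<beta>. \<beta> ^ (m + n) * inner_measure M A) \<longlongrightarrow> \<alpha> ^ (m + n) * inner_measure M A) (at_right \<alpha>)"
    by (intro tendsto_intros)
  moreover have "\<forall>\<^sub>F \<beta> in at_right \<alpha>. measure M (diff_sumset m n C) \<le> \<beta> ^ (m + n) * inner_measure M A"
    using eventually_at_right_less[of \<alpha>] less by (rule eventually_mono)
  ultimately show ?thesis
    by (rule tendsto_lowerbound) simp
qed

text \<open>A measurable hull \<open>H\<close> from outside and compact sets \<open>mC - nC\<close>
  from inside agree in measure up to any \<open>e\<close>, so \<open>mB - nB\<close> is measurable
  for the completion. The bound for compact sets passes to \<open>H\<close>.\<close>

lemma plunnecke_K_analytic:
  assumes B: "K_analytic TYPE('b) euclidean B"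
    and pos: "0 < inner_measure M (sumset A B)"
    and le: "inner_measure M (sumset A B) \<le> \<alpha> * inner_measure M A"
  shows "diff_sumset m n B \<in> sets (completion M)"
    and "measure (completion M) (diff_sumset m n B) \<le> \<alpha> ^ (m + n) * inner_measure M A"
proof -
  let ?b = "\<alpha> ^ (m + n) * inner_measure M A"
  have "B \<noteq> {}"
  proof
    assume "B = {}"
    then have "sumset A B = {}" by (simp add: sumset_def)
    then show False using pos less_inner_measureE[of 0 "{}"] by auto
  qed
  then obtain b where b: "b \<in> B" by auto
  obtain H where H: "H \<in> sets M" "diff_sumset m n B \<subseteq> H"
      "outer_measure_of M (diff_sumset m n B) = emeasure M H"
    using outer_measure_of_attain[of "diff_sumset m n B" M] by auto
  have approx: "\<exists>C. compact C \<and> C \<subseteq> B \<and> C \<noteq> {} \<and> measure M H - e \<le> measure M (diff_sumset m n C)"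
    if e: "0 < e" for e
  proof (cases "measure M H = 0")
    \<comment> \<open>Capacitability needs a value strictly below the outer measure, which is
      impossible here because \<open>ennreal\<close> sends negative reals to 0; a point of
      \<open>B\<close> serves instead.\<close>
    case True
    have "measure M H - e \<le> measure M (diff_sumset m n {b})"
      using True e measure_nonneg[of M "diff_sumset m n {b}"] by linarith
    with b show ?thesis
      by (intro exI[of _ "{b}"]) simp
  next
    case False
    then have "0 < measure M H" using measure_nonneg[of M H] by linarith
    then have "ennreal (measure M H - e) < outer_measure_of M (diff_sumset m n B)"
      unfolding H(3) emeasure_eq_measure using e by (intro ennreal_lessI) auto
    then obtain C where C: "compact C" "C \<subseteq> B" "measure M H - e \<le> measure M (diff_sumset m n C)"
      by (rule K_analytic_capacitable[OF B])
    \<comment> \<open>Adjoining \<open>b\<close> ensures the nonemptiness that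
      \<open>plunnecke_compact_summand\<close> asks for.\<close>
    have "compact (insert b C)"
      using C(1) by (rule compact_insert)
    then have "measure M (diff_sumset m n C) \<le> measure M (diff_sumset m n (insert b C))"
      by (intro finite_measure_mono compact_in_M compact_diff_sumset diff_sumset_mono) auto
    with C b \<open>compact (insert b C)\<close> show ?thesis
      by (intro exI[of _ "insert b C"]) auto
  qed
  have bH: "measure M H \<le> ?b"
  proof (rule field_le_epsilon)
    fix e :: real assume "0 < e"
    from approx[OF this] obtain C where
      "compact C" "C \<subseteq> B" "C \<noteq> {}" "measure M H - e \<le> measure M (diff_sumset m n C)"
      by blast
    with plunnecke_compact_summand[OF pos le, of C m n] show "measure M H \<le> ?b + e"
      by simp
  qed
  have fin: "X \<in> fmeasurable (completion M)" if "X \<in> sets M" for X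
    using that by (simp add: fmeasurable_def emeasure_eq_measure)
  have "diff_sumset m n B \<in> fmeasurable (completion M)"
    unfolding completion.fmeasurable_inner_outer
  proof (intro allI impI)
    fix e :: real assume "0 < e"
    then obtain C where C: "compact C" "C \<subseteq> B" "measure M H - e / 2 \<le> measure M (diff_sumset m n C)"
      using approx[of "e / 2"] by auto
    have sub: "diff_sumset m n C \<subseteq> diff_sumset m n B"
      using C by (intro diff_sumset_mono)
    have setC: "diff_sumset m n C \<in> sets M"
      using C by (intro compact_in_M compact_diff_sumset)
    have "measure M (diff_sumset m n C) \<le> measure M H"
      using H sub by (intro finite_measure_mono) auto
    with C \<open>0 < e\<close> have "\<bar>measure (completion M) (diff_sumset m n C) - measure (completion M) H\<bar> < e"
      using setC H by simp
    with sub setC H fin show "\<exists>T\<in>fmeasurable (completion M). \<exists>U\<in>fmeasurable (completion M).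
        T \<subseteq> diff_sumset m n B \<and> diff_sumset m n B \<subseteq> U \<and>
        \<bar>measure (completion M) T - measure (completion M) U\<bar> < e"
      by blast
  qed
  then show meas: "diff_sumset m n B \<in> sets (completion M)"
    by (simp add: fmeasurableD)
  have "measure (completion M) (diff_sumset m n B) \<le> measure (completion M) H"
    using meas H fin by (intro measure_mono_fmeasurable)
  with bH H show "measure (completion M) (diff_sumset m n B) \<le> ?b"
    by simp
qed

end

text \<open>K-analytic sets need not be Borel, so \<open>mB - nB\<close> is measured in the
  completion of \<open>M\<close>.\<close>

theorem theorem5p1:
  fixes M :: "'a::{t2_space, ab_group_add} measure"
    and A B :: "'a set" and \<alpha> :: real
  assumes "compact_topological_ab_group TYPE('a)"
    and "haar_prob_measure M"
    and "K_analytic TYPE('b) euclidean B"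
    and "0 < inner_measure M (sumset A B)"
    and "inner_measure M (sumset A B) \<le> \<alpha> * inner_measure M A"
  shows "\<forall>m n :: nat. diff_sumset m n B \<in> sets (completion M) \<and>
           measure (completion M) (diff_sumset m n B) \<le> \<alpha> ^ (m + n) * inner_measure M A"
proof -
  interpret compact_haar_group M
    using assms(1,2) by unfold_locales
  show ?thesis
    using plunnecke_K_analytic[OF assms(3-5)] by blast
qed

end
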